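(* Let $(X_1,d_1)$ and $(X_2,d_2)$ be two pointed quasi-metric spaces, and $f\in\mathrm{SLip}_0(X_1,X_2)$. Then there is a unique linear map $\hat T_f:\mathcal{F}_a(X_1)\to\mathcal{F}_a(X_2)$ such that $\hat T_f\circ\delta_{X_1}=\delta_{X_2}\circ f$ and $\|\hat T_f|=\|f|_S$, where $\delta_{X_1}$ and $\delta_{X_2}$ are the canonical isometric injections of $(X_1,d_1)$ and $(X_2,d_2)$ into their semi-Lipschitz free spaces.
   Context: A quasi-metric space is a pair $(X,d)$ with $X\ne\emptyset$ and $d:X\times X\to[0,\infty)$ satisfying the triangle inequality $d(x,y)\le d(x,z)+d(z,y)$ and either ($x=y\iff d(x,y)=0$) or ($x=y\iff d(x,y)=d(y,x)=0$); both variants are allowed. Pointed means that a base point is fixed. $\mathrm{SLip}_0(X_1,X_2)$ is the set of maps $f:X_1\to X_2$ sending the base point of $X_1$ to that of $X_2$ for which there is $L\ge0$ with $d_2(f(y),f(x))\le L\,d_1(y,x)$ for all $x,y\in X_1$; $\|f|_S$ is the infimum of the $L>0$ with this property. For a pointed quasi-metric space $(X,d)$ with base point $x_0$: $\mathrm{SLip}_0(X)$ is the cone of $g:X\to\mathbb{R}$ with $g(x_0)=0$ for which there is $L>0$ with $g(x)-g(y)\le L\,d(y,x)$ for all $x,y$, and $\|g|_S$ is the infimum of such $L$. For $x\in X$, $\delta_X(x)$ is the evaluation $g\mapsto g(x)$ on $\mathrm{SLip}_0(X)$. On the vector space $\mathrm{span}(\delta_X(X))$ put $\|\gamma|^*=\sup\{\gamma(g):\|g|_S\le1\}$;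 this is an asymmetric (hemi-)norm: finite, nonnegative, subadditive, positively homogeneous, with $\gamma=0\iff\|\gamma|^*=\|{-\gamma}|^*=0$. The semi-Lipschitz free space $\mathcal{F}_a(X)$ is its bicompletion, i.e. the (unique up to isometric isomorphism) asymmetric normed space, complete for the symmetrized norm $\|\gamma|^*+\|{-\gamma}|^*$, containing $\mathrm{span}(\delta_X(X))$ isometrically as a linear subspace dense for the symmetrized norm. For a linear map $T:\mathcal{F}_a(X_1)\to\mathcal{F}_a(X_2)$, $\|T|=\sup\{\|T\gamma|^*:\|\gamma|^*\le1\}$. *)

theory Defs
  imports "HOL-Analysis.Analysis" "HOL-Library.Function_Algebras"
begin

text \<open>Pointwise scalar multiplication, which makes spaces of functions into real vector spaces.\<close>

instantiation "fun" :: (type, real_vector) real_vector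
begin

definition scaleR_fun_def: "r *\<^sub>R f = (\<lambda>x. r *\<^sub>R f x)"

instance
  by standard (simp_all add: scaleR_fun_def fun_eq_iff algebra_simps)

end

lemma scaleR_fun_apply [simp]: "(r *\<^sub>R f) x = r *\<^sub>R f x"
  by (simp add: scaleR_fun_def)


section \<open>Quasi-metric spaces and semi-Lipschitz maps\<close>

text \<open>Both variants of the separation axiom are allowed; no symmetry is required.\<close>

definition quasi_metric :: "'a set \<Rightarrow> ('a \<Rightarrow> 'a \<Rightarrow> real) \<Rightarrow> bool" where
  "quasi_metric X d \<longleftrightarrow>
     X \<noteq> {} \<and>
     (\<forall>x\<in>X. \<forall>y\<in>X. 0 \<le> d x y) \<and>
     (\<forall>x\<in>X. \<forall>y\<in>X. \<forall>z\<in>X. d x y \<le> d x z + d z y) \<and>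
     ((\<forall>x\<in>X. \<forall>y\<in>X. x = y \<longleftrightarrow> d x y = 0) \<or>
      (\<forall>x\<in>X. \<forall>y\<in>X. x = y \<longleftrightarrow> d x y = 0 \<and> d y x = 0))"

definition pointed_quasi_metric :: "'a set \<Rightarrow> ('a \<Rightarrow> 'a \<Rightarrow> real) \<Rightarrow> 'a \<Rightarrow> bool" where
  "pointed_quasi_metric X d x0 \<longleftrightarrow> quasi_metric X d \<and> x0 \<in> X"

definition SLip0_map ::
  "'a set \<Rightarrow> ('a \<Rightarrow> 'a \<Rightarrow> real) \<Rightarrow> 'a \<Rightarrow> 'b set \<Rightarrow> ('b \<Rightarrow> 'b \<Rightarrow> real) \<Rightarrow> 'b \<Rightarrow> ('a \<Rightarrow> 'b) set" where
  "SLip0_map X1 d1 x1 X2 d2 x2 =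
     {f \<in> X1 \<rightarrow> X2. f x1 = x2 \<and>
        (\<exists>L\<ge>0. \<forall>x\<in>X1. \<forall>y\<in>X1. d2 (f y) (f x) \<le> L * d1 y x)}"

definition slip_map_norm ::
  "'a set \<Rightarrow> ('a \<Rightarrow> 'a \<Rightarrow> real) \<Rightarrow> ('b \<Rightarrow> 'b \<Rightarrow> real) \<Rightarrow> ('a \<Rightarrow> 'b) \<Rightarrow> real" where
  "slip_map_norm X1 d1 d2 f =
     Inf {L. L > 0 \<and> (\<forall>x\<in>X1. \<forall>y\<in>X1. d2 (f y) (f x) \<le> L * d1 y x)}"

text \<open>A function \<open>X \<rightarrow> \<real>\<close> is represented by its extension by zero, so that the cone
  is closed under the pointwise operations and equality is equality on \<open>X\<close>.\<close>

definition SLip0 :: "'a set \<Rightarrow> ('a \<Rightarrow> 'a \<Rightarrow> real) \<Rightarrow> 'a \<Rightarrow> ('a \<Rightarrow> real) set" where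
  "SLip0 X d x0 =
     {g. (\<forall>x. x \<notin> X \<longrightarrow> g x = 0) \<and> g x0 = 0 \<and>
         (\<exists>L>0. \<forall>x\<in>X. \<forall>y\<in>X. g x - g y \<le> L * d y x)}"

definition slip_norm :: "'a set \<Rightarrow> ('a \<Rightarrow> 'a \<Rightarrow> real) \<Rightarrow> ('a \<Rightarrow> real) \<Rightarrow> real" where
  "slip_norm X d g = Inf {L. L > 0 \<and> (\<forall>x\<in>X. \<forall>y\<in>X. g x - g y \<le> L * d y x)}"

definition slip_ball :: "'a set \<Rightarrow> ('a \<Rightarrow> 'a \<Rightarrow> real) \<Rightarrow> 'a \<Rightarrow> ('a \<Rightarrow> real) set" where
  "slip_ball X d x0 = {g \<in> SLip0 X d x0. slip_norm X d g \<le> 1}"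

text \<open>Functionals on \<open>SLip0 X d x0\<close> are likewise extended by zero outside that cone.\<close>

definition delta :: "'a set \<Rightarrow> ('a \<Rightarrow> 'a \<Rightarrow> real) \<Rightarrow> 'a \<Rightarrow> 'a \<Rightarrow> ('a \<Rightarrow> real) \<Rightarrow> real" where
  "delta X d x0 x = (\<lambda>g. if g \<in> SLip0 X d x0 then g x else 0)"

definition delta_span :: "'a set \<Rightarrow> ('a \<Rightarrow> 'a \<Rightarrow> real) \<Rightarrow> 'a \<Rightarrow> (('a \<Rightarrow> real) \<Rightarrow> real) set" where
  "delta_span X d x0 = span (delta X d x0 ` X)"

definition dual_norm ::
  "'a set \<Rightarrow> ('a \<Rightarrow> 'a \<Rightarrow> real) \<Rightarrow> 'a \<Rightarrow> (('a \<Rightarrow> real) \<Rightarrow> real) \<Rightarrow> real" where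
  "dual_norm X d x0 \<gamma> = (SUP g\<in>slip_ball X d x0. \<gamma> g)"


section \<open>Asymmetric normed spaces and bicompletions\<close>

definition linear_map_on :: "'v::real_vector set \<Rightarrow> ('v \<Rightarrow> 'w::real_vector) \<Rightarrow> bool" where
  "linear_map_on V T \<longleftrightarrow>
     (\<forall>u\<in>V. \<forall>v\<in>V. T (u + v) = T u + T v) \<and> (\<forall>r. \<forall>u\<in>V. T (r *\<^sub>R u) = r *\<^sub>R T u)"

definition asym_norm_on :: "'v::real_vector set \<Rightarrow> ('v \<Rightarrow> real) \<Rightarrow> bool" where
  "asym_norm_on V p \<longleftrightarrow>
     subspace V \<and>
     (\<forall>u\<in>V. 0 \<le> p u) \<and>
     (\<forall>u\<in>V. \<forall>v\<in>V. p (u + v) \<le> p u + p v) \<and>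
     (\<forall>t\<ge>0. \<forall>u\<in>V. p (t *\<^sub>R u) = t * p u) \<and>
     (\<forall>u\<in>V. u = 0 \<longleftrightarrow> p u = 0 \<and> p (- u) = 0)"

definition sym_norm :: "('v::real_vector \<Rightarrow> real) \<Rightarrow> 'v \<Rightarrow> real" where
  "sym_norm p u = p u + p (- u)"

definition bicomplete_on :: "'v::real_vector set \<Rightarrow> ('v \<Rightarrow> real) \<Rightarrow> bool" where
  "bicomplete_on V p \<longleftrightarrow>
     (\<forall>\<sigma>::nat \<Rightarrow> 'v. range \<sigma> \<subseteq> V \<longrightarrow>
        (\<forall>e>0. \<exists>N. \<forall>m\<ge>N. \<forall>n\<ge>N. sym_norm p (\<sigma> m - \<sigma> n) < e) \<longrightarrow>
        (\<exists>l\<in>V. (\<lambda>n. sym_norm p (\<sigma> n - l)) \<longlonglongrightarrow> 0))"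

text \<open>\<open>(F, p)\<close>, together with the isometric linear embedding \<open>j\<close> of \<open>(V, q)\<close> into it, is a
  bicompletion of \<open>(V, q)\<close>.\<close>

definition bicompletion ::
  "'v::real_vector set \<Rightarrow> ('v \<Rightarrow> real) \<Rightarrow> 'w::real_vector set \<Rightarrow> ('w \<Rightarrow> real) \<Rightarrow> ('v \<Rightarrow> 'w) \<Rightarrow> bool" where
  "bicompletion V q F p j \<longleftrightarrow>
     asym_norm_on F p \<and> bicomplete_on F p \<and>
     j ` V \<subseteq> F \<and> linear_map_on V j \<and> (\<forall>\<gamma>\<in>V. p (j \<gamma>) = q \<gamma>) \<and>
     (\<forall>u\<in>F. \<forall>e>0. \<exists>\<gamma>\<in>V. sym_norm p (u - j \<gamma>) < e)"

text \<open>The semi-Lipschitz free space is determined only up to isometric isomorphism, hence it is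
  a predicate: \<open>(F, p)\<close> is a semi-Lipschitz free space of \<open>(X, d, x0)\<close>, and the canonical
  injection of \<open>X\<close> into it is \<open>j \<circ> delta X d x0\<close>. See \<open>free_space_exists\<close> below for existence.\<close>

definition semi_lipschitz_free_space ::
  "'a set \<Rightarrow> ('a \<Rightarrow> 'a \<Rightarrow> real) \<Rightarrow> 'a \<Rightarrow>
   'v::real_vector set \<Rightarrow> ('v \<Rightarrow> real) \<Rightarrow> ((('a \<Rightarrow> real) \<Rightarrow> real) \<Rightarrow> 'v) \<Rightarrow> bool" where
  "semi_lipschitz_free_space X d x0 F p j \<longleftrightarrow>
     bicompletion (delta_span X d x0) (dual_norm X d x0) F p j"

text \<open>The norm of an arbitrary linear map may be infinite, so the supremum is taken in
  the extended reals.\<close>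

definition asym_op_norm ::
  "'v::real_vector set \<Rightarrow> ('v \<Rightarrow> real) \<Rightarrow> ('w::real_vector \<Rightarrow> real) \<Rightarrow> ('v \<Rightarrow> 'w) \<Rightarrow> ereal" where
  "asym_op_norm F1 p1 p2 T = (SUP u\<in>{u \<in> F1. p1 u \<le> 1}. ereal (p2 (T u)))"


section \<open>Existence of the semi-Lipschitz free space\<close>

lemma slip_ball_le:
  assumes X: "quasi_metric X d" and g: "g \<in> slip_ball X d x0" and x: "x \<in> X" and y: "y \<in> X"
  shows "g x - g y \<le> d y x"
proof (rule field_le_epsilon)
  fix e :: real assume e: "e > 0"
  let ?S = "{L. L > 0 \<and> (\<forall>x\<in>X. \<forall>y\<in>X. g x - g y \<le> L * d y x)}"
  have d0: "0 \<le> d y x" using X x y by (auto simp: quasi_metric_def)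
  define r where "r = e / (d y x + 1)"
  have r: "r > 0" using e d0 by (simp add: r_def)
  have ne: "?S \<noteq> {}" using g by (auto simp: slip_ball_def SLip0_def)
  have "Inf ?S < 1 + r" using g r by (simp add: slip_ball_def slip_norm_def)
  then obtain L where L: "L \<in> ?S" "L < 1 + r"
    using cInf_lessD[OF ne] by blast
  have "g x - g y \<le> L * d y x" using L x y by blast
  also have "\<dots> \<le> (1 + r) * d y x" using L d0 by (intro mult_right_mono) auto
  also have "\<dots> = d y x + e * (d y x / (d y x + 1))" by (simp add: r_def algebra_simps)
  also have "\<dots> \<le> d y x + e * 1"
    using e d0 by (intro add_left_mono mult_left_mono) (auto simp: divide_simps)
  finally show "g x - g y \<le> d y x + e" by simp
qed

lemma slip_ballI:
  assumes "\<And>x. x \<notin> X \<Longrightarrow> g x = 0" "g x0 = 0" "\<And>x y. x \<in> X \<Longrightarrow> y \<in> X \<Longrightarrow> g x - g y \<le> d y x"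
  shows "g \<in> slip_ball X d x0"
proof -
  let ?S = "{L. L > 0 \<and> (\<forall>x\<in>X. \<forall>y\<in>X. g x - g y \<le> L * d y x)}"
  have "(1::real) \<in> ?S" using assms by auto
  moreover have "bdd_below ?S" by (rule bdd_belowI[of _ 0]) auto
  ultimately have "Inf ?S \<le> 1" by (rule cInf_lower)
  moreover have "g \<in> SLip0 X d x0"
    unfolding SLip0_def using assms by (auto intro!: exI[of _ 1])
  ultimately show ?thesis by (simp add: slip_ball_def slip_norm_def)
qed

lemma slip_ball_subset: "g \<in> slip_ball X d x0 \<Longrightarrow> g \<in> SLip0 X d x0"
  by (simp add: slip_ball_def)

lemma zero_in_slip_ball: "quasi_metric X d \<Longrightarrow> 0 \<in> slip_ball X d x0"
  by (rule slip_ballI) (auto simp: quasi_metric_def)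

lemma SLip0_scale:
  assumes "quasi_metric X d" "g \<in> SLip0 X d x0" "t \<ge> 0"
  shows "t *\<^sub>R g \<in> SLip0 X d x0"
proof -
  obtain L where L: "L > 0" "\<forall>x\<in>X. \<forall>y\<in>X. g x - g y \<le> L * d y x"
    using assms by (auto simp: SLip0_def)
  have "t * g x - t * g y \<le> (t * L + 1) * d y x" if "x \<in> X" "y \<in> X" for x y
  proof -
    have "t * (g x - g y) \<le> t * (L * d y x)" using L that assms by (intro mult_left_mono) auto
    moreover have "0 \<le> d y x" using assms that by (auto simp: quasi_metric_def)
    ultimately show ?thesis by (simp add: algebra_simps)
  qed
  moreover have "t * L + 1 > 0" using L assms by (simp add: add_nonneg_pos)
  ultimately show ?thesis using assms by (auto simp: SLip0_def)
qed

lemma SLip0_rescale: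
  assumes "g \<in> SLip0 X d x0"
  obtains L h where "L > 0" "h \<in> slip_ball X d x0" "g = L *\<^sub>R h"
proof -
  obtain L where L: "L > 0" "\<forall>x\<in>X. \<forall>y\<in>X. g x - g y \<le> L * d y x"
    using assms by (auto simp: SLip0_def)
  have "(1/L) *\<^sub>R g \<in> slip_ball X d x0"
  proof (rule slip_ballI)
    fix x y assume "x \<in> X" "y \<in> X"
    then have "(g x - g y) / L \<le> d y x" using L by (simp add: divide_simps mult.commute)
    then show "((1/L) *\<^sub>R g) x - ((1/L) *\<^sub>R g) y \<le> d y x" by (simp add: diff_divide_distrib)
  qed (use assms in \<open>auto simp: SLip0_def\<close>)
  moreover have "g = L *\<^sub>R ((1/L) *\<^sub>R g)" using L by simp
  ultimately show ?thesis using L that by blast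
qed

text \<open>The canonical injection is isometric; note the order of the arguments.\<close>

lemma delta_isometric:
  assumes X: "pointed_quasi_metric X d x0" and x: "x \<in> X" and y: "y \<in> X"
  shows "dual_norm X d x0 (delta X d x0 x - delta X d x0 y) = d y x"
proof -
  have q: "quasi_metric X d" "x0 \<in> X" using X by (auto simp: pointed_quasi_metric_def)
  have z: "d y y = 0" and tri: "\<And>u v. u \<in> X \<Longrightarrow> v \<in> X \<Longrightarrow> d y u \<le> d y v + d v u"
    using q y unfolding quasi_metric_def by metis+
  define h where "h = (\<lambda>u. if u \<in> X then d y u - d y x0 else 0)"
  have h: "h \<in> slip_ball X d x0"
  proof (rule slip_ballI)
    fix u v assume "u \<in> X" "v \<in> X"
    with tri[of u v] show "h u - h v \<le> d v u" by (simp add: h_def)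
  qed (auto simp: h_def q)
  have val: "(delta X d x0 x - delta X d x0 y) g = g x - g y" if "g \<in> slip_ball X d x0" for g
    using slip_ball_subset[OF that] by (simp add: delta_def)
  have "(SUP g\<in>slip_ball X d x0. (delta X d x0 x - delta X d x0 y) g) = d y x"
  proof (rule cSup_eq_maximum)
    have "(delta X d x0 x - delta X d x0 y) h = d y x"
      using val[OF h] by (simp only: h_def x y z if_True)
    then show "d y x \<in> (\<lambda>g. (delta X d x0 x - delta X d x0 y) g) ` slip_ball X d x0"
      using h by force
  next
    fix r assume "r \<in> (\<lambda>g. (delta X d x0 x - delta X d x0 y) g) ` slip_ball X d x0"
    then show "r \<le> d y x" using val slip_ball_le[OF q(1) _ x y] by auto
  qed
  then show ?thesis by (simp add: dual_norm_def)
qed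

lemma delta_span_props:
  assumes X: "pointed_quasi_metric X d x0" and "\<gamma> \<in> delta_span X d x0"
  shows "(\<forall>g. g \<notin> SLip0 X d x0 \<longrightarrow> \<gamma> g = 0) \<and>
    (\<forall>g\<in>SLip0 X d x0. \<forall>t\<ge>0. \<gamma> (t *\<^sub>R g) = t * \<gamma> g) \<and>
    (\<exists>C. \<forall>g\<in>slip_ball X d x0. \<bar>\<gamma> g\<bar> \<le> C)"
proof -
  have q: "quasi_metric X d" "x0 \<in> X" using X by (auto simp: pointed_quasi_metric_def)
  from assms(2) show ?thesis unfolding delta_span_def
  proof (induction rule: span_induct_alt)
    case base
    then show ?case by auto
  next
    case (step c u v)
    then obtain x where x: "x \<in> X" "u = delta X d x0 x" by auto
    obtain C where C: "\<forall>g\<in>slip_ball X d x0. \<bar>v g\<bar> \<le> C" using step by blast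
    have b: "\<bar>u g\<bar> \<le> d x0 x + d x x0" if "g \<in> slip_ball X d x0" for g
    proof -
      have "g x0 = 0" using that by (auto simp: slip_ball_def SLip0_def)
      moreover have "0 \<le> d x0 x" "0 \<le> d x x0" using q x by (auto simp: quasi_metric_def)
      ultimately show ?thesis
        using slip_ball_le[OF q(1) that x(1) q(2)] slip_ball_le[OF q(1) that q(2) x(1)]
          slip_ball_subset[OF that] by (simp add: x(2) delta_def)
    qed
    have "\<bar>(c *\<^sub>R u + v) g\<bar> \<le> \<bar>c\<bar> * (d x0 x + d x x0) + C" if "g \<in> slip_ball X d x0" for g
    proof -
      have "\<bar>(c *\<^sub>R u + v) g\<bar> \<le> \<bar>c\<bar> * \<bar>u g\<bar> + \<bar>v g\<bar>" by (simp add: abs_mult flip: abs_mult)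
      also have "\<dots> \<le> \<bar>c\<bar> * (d x0 x + d x x0) + C"
        using b[OF that] C that by (intro add_mono mult_left_mono) auto
      finally show ?thesis .
    qed
    then have "\<exists>C. \<forall>g\<in>slip_ball X d x0. \<bar>(c *\<^sub>R u + v) g\<bar> \<le> C" by blast
    moreover have "u (t *\<^sub>R g) = t * u g" if "g \<in> SLip0 X d x0" "t \<ge> 0" for g t
      using that SLip0_scale[OF q(1) that] by (simp add: x(2) delta_def)
    moreover have "u g = 0" if "g \<notin> SLip0 X d x0" for g
      using that by (simp add: x(2) delta_def)
    moreover have "(c *\<^sub>R u + v) (t *\<^sub>R g) = t * (c *\<^sub>R u + v) g" if "g \<in> SLip0 X d x0" "t \<ge> 0" for g t
    proof -
      have "v (t *\<^sub>R g) = t * v g" using step that by blast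
      then show ?thesis using \<open>\<And>g t. g \<in> SLip0 X d x0 \<Longrightarrow> t \<ge> 0 \<Longrightarrow> u (t *\<^sub>R g) = t * u g\<close>[OF that]
        by (simp only: plus_fun_apply scaleR_fun_apply real_scaleR_def) (simp only: algebra_simps)
    qed
    moreover have "(c *\<^sub>R u + v) g = 0" if "g \<notin> SLip0 X d x0" for g
      using \<open>\<And>g. g \<notin> SLip0 X d x0 \<Longrightarrow> u g = 0\<close>[OF that] step that by simp
    ultimately show ?case by blast
  qed
qed

text \<open>A concrete model: the closure of the span, for uniform convergence on the
  unit ball, in the space of positively homogeneous functionals.\<close>

definition free_space_model :: "'a set \<Rightarrow> ('a \<Rightarrow> 'a \<Rightarrow> real) \<Rightarrow> 'a \<Rightarrow> (('a \<Rightarrow> real) \<Rightarrow> real) set" where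
  "free_space_model X d x0 =
     {\<phi>. (\<forall>g. g \<notin> SLip0 X d x0 \<longrightarrow> \<phi> g = 0) \<and>
         (\<forall>g\<in>SLip0 X d x0. \<forall>t\<ge>0. \<phi> (t *\<^sub>R g) = t * \<phi> g) \<and>
         (\<forall>e>0. \<exists>\<gamma>\<in>delta_span X d x0. \<forall>g\<in>slip_ball X d x0. \<bar>\<phi> g - \<gamma> g\<bar> \<le> e)}"

lemma free_space_exists:
  assumes X: "pointed_quasi_metric X d x0"
  shows "semi_lipschitz_free_space X d x0 (free_space_model X d x0) (dual_norm X d x0) id"
proof -
  have q: "quasi_metric X d" "x0 \<in> X" using X by (auto simp: pointed_quasi_metric_def)
  let ?S = "SLip0 X d x0" and ?B = "slip_ball X d x0" and ?V = "delta_span X d x0"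
    and ?F = "free_space_model X d x0" and ?p = "dual_norm X d x0"
  have B0: "0 \<in> ?B" by (rule zero_in_slip_ball[OF q(1)])
  have S0: "0 \<in> ?S" using B0 by (rule slip_ball_subset)
  have VS: "subspace ?V" by (simp add: delta_span_def)
  have VF: "?V \<subseteq> ?F"
  proof
    fix \<gamma> assume g: "\<gamma> \<in> ?V"
    have "\<forall>e>0. \<exists>\<gamma>'\<in>?V. \<forall>g\<in>?B. \<bar>\<gamma> g - \<gamma>' g\<bar> \<le> e" using g by force
    then show "\<gamma> \<in> ?F" using delta_span_props[OF X g] by (simp add: free_space_model_def)
  qed
  have FS: "subspace ?F"
  proof (rule subspaceI)
    show "0 \<in> ?F" using VF subspace_0[OF VS] by blast
  next
    fix a b assume a: "a \<in> ?F" and b: "b \<in> ?F"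
    have "\<exists>\<gamma>\<in>?V. \<forall>g\<in>?B. \<bar>(a + b) g - \<gamma> g\<bar> \<le> e" if "e > 0" for e
    proof -
      obtain \<gamma> where \<gamma>: "\<gamma> \<in> ?V" "\<forall>g\<in>?B. \<bar>a g - \<gamma> g\<bar> \<le> e/2"
        using a half_gt_zero[OF \<open>e > 0\<close>] unfolding free_space_model_def by blast
      obtain \<eta> where \<eta>: "\<eta> \<in> ?V" "\<forall>g\<in>?B. \<bar>b g - \<eta> g\<bar> \<le> e/2"
        using b half_gt_zero[OF \<open>e > 0\<close>] unfolding free_space_model_def by blast
      have "\<bar>(a + b) g - (\<gamma> + \<eta>) g\<bar> \<le> e" if "g \<in> ?B" for g
        using bspec[OF \<gamma>(2) that] bspec[OF \<eta>(2) that] by (simp; linarith)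
      moreover have "\<gamma> + \<eta> \<in> ?V" using VS \<gamma> \<eta> by (simp add: subspace_add)
      ultimately show ?thesis by blast
    qed
    then show "a + b \<in> ?F" using a b by (simp add: free_space_model_def algebra_simps)
  next
    fix c a assume a: "a \<in> ?F"
    have "\<exists>\<gamma>\<in>?V. \<forall>g\<in>?B. \<bar>(c *\<^sub>R a) g - \<gamma> g\<bar> \<le> e" if "e > 0" for e
    proof -
      have "e / (\<bar>c\<bar> + 1) > 0" using that by simp
      then obtain \<gamma> where \<gamma>: "\<gamma> \<in> ?V" "\<forall>g\<in>?B. \<bar>a g - \<gamma> g\<bar> \<le> e / (\<bar>c\<bar> + 1)"
        using a unfolding free_space_model_def by blast
      have "\<bar>(c *\<^sub>R a) g - (c *\<^sub>R \<gamma>) g\<bar> \<le> e" if "g \<in> ?B" for g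
      proof -
        have "\<bar>(c *\<^sub>R a) g - (c *\<^sub>R \<gamma>) g\<bar> = \<bar>c\<bar> * \<bar>a g - \<gamma> g\<bar>"
          by (simp add: abs_mult flip: right_diff_distrib)
        also have "\<dots> \<le> \<bar>c\<bar> * (e / (\<bar>c\<bar> + 1))" using \<gamma> that by (intro mult_left_mono) auto
        also have "\<dots> \<le> e" using \<open>e > 0\<close> by (simp add: divide_simps algebra_simps)
        finally show ?thesis .
      qed
      moreover have "c *\<^sub>R \<gamma> \<in> ?V" using VS \<gamma> by (simp add: subspace_scale)
      ultimately show ?thesis by blast
    qed
    then show "c *\<^sub>R a \<in> ?F" using a by (simp add: free_space_model_def)
  qed
  have bdd: "bdd_above (\<phi> ` ?B)" if F: "\<phi> \<in> ?F" for \<phi>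
  proof -
    obtain \<gamma> where \<gamma>: "\<gamma> \<in> ?V" "\<forall>g\<in>?B. \<bar>\<phi> g - \<gamma> g\<bar> \<le> 1"
      using F zero_less_one unfolding free_space_model_def by blast
    obtain C where C: "\<forall>g\<in>?B. \<bar>\<gamma> g\<bar> \<le> C" using delta_span_props[OF X \<gamma>(1)] by blast
    show ?thesis
    proof (rule bdd_aboveI2)
      fix g assume "g \<in> ?B"
      then show "\<phi> g \<le> C + 1" using bspec[OF \<gamma>(2)] bspec[OF C] by (fastforce simp: abs_le_iff)
    qed
  qed
  have up: "\<phi> g \<le> ?p \<phi>" if "\<phi> \<in> ?F" "g \<in> ?B" for \<phi> g
    unfolding dual_norm_def using bdd that by (intro cSUP_upper) auto
  have least: "?p \<phi> \<le> C" if "\<And>g. g \<in> ?B \<Longrightarrow> \<phi> g \<le> C" for \<phi> C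
    unfolding dual_norm_def using B0 that by (intro cSUP_least) auto
  have at0: "\<phi> 0 = 0" if "\<phi> \<in> ?F" for \<phi>
  proof -
    have "\<phi> (0 *\<^sub>R 0) = 0 * \<phi> 0" using that S0 unfolding free_space_model_def by blast
    then show ?thesis by simp
  qed
  have nonneg: "0 \<le> ?p \<phi>" if "\<phi> \<in> ?F" for \<phi> using up[OF that B0] at0[OF that] by simp
  have neg: "- \<phi> \<in> ?F" if "\<phi> \<in> ?F" for \<phi> using FS that by (simp add: subspace_neg)
  have absle: "\<bar>\<phi> g\<bar> \<le> sym_norm ?p \<phi>" if "\<phi> \<in> ?F" "g \<in> ?B" for \<phi> g
    using up[OF that] up[OF neg[OF that(1)] that(2)] nonneg[OF that(1)] nonneg[OF neg[OF that(1)]]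
    by (simp add: sym_norm_def abs_le_iff)
  have symle: "sym_norm ?p \<phi> \<le> 2 * C" if "\<And>g. g \<in> ?B \<Longrightarrow> \<bar>\<phi> g\<bar> \<le> C" for \<phi> C
  proof -
    have "?p \<phi> \<le> C" by (rule least) (use that in \<open>simp add: abs_le_iff\<close>)
    moreover have "?p (- \<phi>) \<le> C" by (rule least) (use that in \<open>simp add: abs_le_iff\<close>)
    ultimately show ?thesis by (simp add: sym_norm_def)
  qed
  have asym: "asym_norm_on ?F ?p"
    unfolding asym_norm_on_def
  proof (intro conjI ballI allI impI)
    show "?p (u + v) \<le> ?p u + ?p v" if "u \<in> ?F" "v \<in> ?F" for u v
      by (rule least) (simp add: add_mono up that)
  next
    fix t :: real and u assume t: "0 \<le> t" and u: "u \<in> ?F"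
    have le: "?p (t *\<^sub>R u) \<le> t * ?p u"
      by (rule least) (simp add: mult_left_mono t up u)
    show "?p (t *\<^sub>R u) = t * ?p u"
    proof (cases "t = 0")
      case True
      then show ?thesis using le nonneg[of 0] subspace_0[OF FS] by simp
    next
      case False
      then have t': "t > 0" using t by simp
      have "?p u \<le> ?p (t *\<^sub>R u) / t"
      proof (rule least)
        fix g assume "g \<in> ?B"
        then have "(t *\<^sub>R u) g \<le> ?p (t *\<^sub>R u)" by (rule up[OF subspace_scale[OF FS u]])
        then show "u g \<le> ?p (t *\<^sub>R u) / t" using t' by (simp add: pos_le_divide_eq mult.commute)
      qed
      then have "t * ?p u \<le> ?p (t *\<^sub>R u)" using t' by (simp only: pos_le_divide_eq mult.commute)
      then show ?thesis using le by linarith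
    qed
  next
    fix u assume u: "u \<in> ?F"
    show "u = 0 \<longleftrightarrow> ?p u = 0 \<and> ?p (- u) = 0"
    proof
      assume "u = 0"
      moreover have "?p 0 = 0" using least[of 0 0] nonneg[of 0] subspace_0[OF FS] by simp
      ultimately show "?p u = 0 \<and> ?p (- u) = 0" by simp
    next
      assume "?p u = 0 \<and> ?p (- u) = 0"
      then have B: "u g = 0" if "g \<in> ?B" for g using absle[OF u that] by (simp add: sym_norm_def)
      show "u = 0"
      proof
        fix g
        show "u g = 0 g"
        proof (cases "g \<in> ?S")
          case True
          then obtain L h where "L > 0" "h \<in> ?B" "g = L *\<^sub>R h" by (rule SLip0_rescale)
          moreover from this have "u (L *\<^sub>R h) = L * u h"
            using u slip_ball_subset[of h] by (simp add: free_space_model_def)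
          ultimately show ?thesis using B by simp
        qed (use u in \<open>simp add: free_space_model_def\<close>)
      qed
    qed
  qed (use FS nonneg in auto)
  have dense: "\<exists>\<gamma>\<in>?V. sym_norm ?p (u - id \<gamma>) < e" if u: "u \<in> ?F" and e: "e > 0" for u e
  proof -
    have "e/3 > 0" using e by simp
    then obtain \<gamma> where \<gamma>: "\<gamma> \<in> ?V" "\<forall>g\<in>?B. \<bar>u g - \<gamma> g\<bar> \<le> e/3"
      using u unfolding free_space_model_def by blast
    have "sym_norm ?p (u - \<gamma>) \<le> 2 * (e/3)" by (rule symle) (use \<gamma> in auto)
    then show ?thesis using \<gamma> e by (intro bexI[of _ \<gamma>]) auto
  qed
  have complete: "bicomplete_on ?F ?p"
    unfolding bicomplete_on_def
  proof (intro allI impI)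
    fix \<sigma> :: "nat \<Rightarrow> ('a \<Rightarrow> real) \<Rightarrow> real"
    assume range: "range \<sigma> \<subseteq> ?F"
      and cauchy: "\<forall>e>0. \<exists>N. \<forall>m\<ge>N. \<forall>n\<ge>N. sym_norm ?p (\<sigma> m - \<sigma> n) < e"
    have \<sigma>: "\<sigma> n \<in> ?F" for n using range by auto
    have hom: "\<sigma> n (t *\<^sub>R g) = t * \<sigma> n g" if "g \<in> ?S" "t \<ge> 0" for n g t
      using \<sigma>[of n] that by (simp add: free_space_model_def)
    have out: "\<sigma> n g = 0" if "g \<notin> ?S" for n g
      using \<sigma>[of n] that by (simp add: free_space_model_def)
    have unif: "\<exists>N. \<forall>m\<ge>N. \<forall>n\<ge>N. \<forall>g\<in>?B. \<bar>\<sigma> m g - \<sigma> n g\<bar> < e" if "e > 0" for e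
    proof -
      obtain N where N: "\<forall>m\<ge>N. \<forall>n\<ge>N. sym_norm ?p (\<sigma> m - \<sigma> n) < e" using cauchy \<open>e > 0\<close> by blast
      have "\<bar>\<sigma> m g - \<sigma> n g\<bar> < e" if "m \<ge> N" "n \<ge> N" "g \<in> ?B" for m n g
      proof -
        have "\<bar>(\<sigma> m - \<sigma> n) g\<bar> \<le> sym_norm ?p (\<sigma> m - \<sigma> n)"
          by (rule absle[OF subspace_diff[OF FS \<sigma> \<sigma>] that(3)])
        also have "\<dots> < e" using N that by blast
        finally show ?thesis by simp
      qed
      then show ?thesis by blast
    qed
    have convB: "convergent (\<lambda>n. \<sigma> n g)" if g: "g \<in> ?B" for g
    proof (rule Cauchy_convergent, rule metric_CauchyI)
      fix e :: real assume "0 < e"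
      then show "\<exists>M. \<forall>m\<ge>M. \<forall>n\<ge>M. dist (\<sigma> m g) (\<sigma> n g) < e"
        unfolding dist_real_def using unif[of e] g by blast
    qed
    define l where "l g = lim (\<lambda>n. \<sigma> n g)" for g
    have lim: "(\<lambda>n. \<sigma> n g) \<longlonglongrightarrow> l g" for g
    proof (cases "g \<in> ?S")
      case True
      then obtain L h where h: "L > 0" "h \<in> ?B" "g = L *\<^sub>R h" by (rule SLip0_rescale)
      then have "(\<lambda>n. \<sigma> n g) = (\<lambda>n. L * \<sigma> n h)" using hom slip_ball_subset[of h] by auto
      moreover have "convergent (\<lambda>n. L * \<sigma> n h)"
        using convB[OF h(2)] by (auto simp: convergent_def intro: tendsto_mult_left)
      ultimately show ?thesis by (simp add: l_def convergent_LIMSEQ_iff)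
    next
      case False
      then show ?thesis using out by (simp add: l_def)
    qed
    have lunif: "\<exists>N. \<forall>n\<ge>N. \<forall>g\<in>?B. \<bar>\<sigma> n g - l g\<bar> \<le> e" if "e > 0" for e
    proof -
      obtain N where N: "\<forall>m\<ge>N. \<forall>n\<ge>N. \<forall>g\<in>?B. \<bar>\<sigma> m g - \<sigma> n g\<bar> < e" using unif \<open>e > 0\<close> by blast
      have "\<bar>\<sigma> n g - l g\<bar> \<le> e" if "n \<ge> N" "g \<in> ?B" for n g
      proof (rule LIMSEQ_le_const2)
        show "(\<lambda>m. \<bar>\<sigma> n g - \<sigma> m g\<bar>) \<longlonglongrightarrow> \<bar>\<sigma> n g - l g\<bar>"
          by (intro tendsto_intros lim)
        show "\<exists>M. \<forall>m\<ge>M. \<bar>\<sigma> n g - \<sigma> m g\<bar> \<le> e" using N that by (meson less_imp_le)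
      qed
      then show ?thesis by blast
    qed
    have lF: "l \<in> ?F"
    proof -
      have "l g = 0" if "g \<notin> ?S" for g
        using LIMSEQ_unique[OF lim[of g]] out[OF that] by simp
      moreover have "l (t *\<^sub>R g) = t * l g" if "g \<in> ?S" "t \<ge> 0" for g t
      proof (rule LIMSEQ_unique[OF lim])
        show "(\<lambda>n. \<sigma> n (t *\<^sub>R g)) \<longlonglongrightarrow> t * l g"
          using hom[OF that] tendsto_mult_left[OF lim[of g], of t] by simp
      qed
      moreover have "\<exists>\<gamma>\<in>?V. \<forall>g\<in>?B. \<bar>l g - \<gamma> g\<bar> \<le> e" if e: "e > 0" for e
      proof -
        have e2: "e/2 > 0" using e by simp
        obtain N where N: "\<forall>g\<in>?B. \<bar>\<sigma> N g - l g\<bar> \<le> e/2" using lunif[OF e2] by blast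
        obtain \<gamma> where \<gamma>: "\<gamma> \<in> ?V" "\<forall>g\<in>?B. \<bar>\<sigma> N g - \<gamma> g\<bar> \<le> e/2"
          using \<sigma>[of N] e2 unfolding free_space_model_def by blast
        have "\<bar>l g - \<gamma> g\<bar> \<le> e" if "g \<in> ?B" for g
          using bspec[OF N that] bspec[OF \<gamma>(2) that] by linarith
        then show ?thesis using \<gamma> by blast
      qed
      ultimately show ?thesis by (simp add: free_space_model_def)
    qed
    have "(\<lambda>n. sym_norm ?p (\<sigma> n - l)) \<longlonglongrightarrow> 0"
    proof (rule LIMSEQ_I)
      fix r :: real assume r: "0 < r"
      then obtain N where N: "\<forall>n\<ge>N. \<forall>g\<in>?B. \<bar>\<sigma> n g - l g\<bar> \<le> r/3" using lunif[of "r/3"] by auto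
      have "norm (sym_norm ?p (\<sigma> n - l) - 0) < r" if "n \<ge> N" for n
      proof -
        have "sym_norm ?p (\<sigma> n - l) \<le> 2 * (r/3)" by (rule symle) (use N that in auto)
        moreover have "0 \<le> sym_norm ?p (\<sigma> n - l)"
          unfolding sym_norm_def
          by (intro add_nonneg_nonneg nonneg neg subspace_diff[OF FS \<sigma> lF])
        ultimately show ?thesis using r by simp
      qed
      then show "\<exists>no. \<forall>n\<ge>no. norm (sym_norm ?p (\<sigma> n - l) - 0) < r" by blast
    qed
    then show "\<exists>l\<in>?F. (\<lambda>n. sym_norm ?p (\<sigma> n - l)) \<longlonglongrightarrow> 0" using lF by blast
  qed
  show ?thesis
    unfolding semi_lipschitz_free_space_def bicompletion_def
    using asym complete VF dense by (simp add: linear_map_on_def)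
qed

end

theory Submission
  imports Defs
begin

text \<open>
  A semi-Lipschitz map \<open>f\<close> acts on semi-Lipschitz functions by composition, \<open>g \<mapsto> g \<circ> f\<close>, and
  the functions with \<open>\<parallel>g|\<^sub>S \<le> 1\<close> are sent to functions of norm at most \<open>\<parallel>f|\<^sub>S\<close>.  The transpose of
  this operation sends the evaluation at \<open>x\<close> to the evaluation at \<open>f x\<close>.  It is therefore a
  linear map between the spans of the evaluations, and its norm is at most \<open>\<parallel>f|\<^sub>S\<close>
  (\<open>dual_norm_pushforward_le\<close>).

  A bound \<open>p' (S \<gamma>) \<le> C * p \<gamma>\<close> for an asymmetric norm also controls the symmetrized norms,
  because \<open>S (- \<gamma>) = - S \<gamma>\<close>.  Hence the map extends by continuity to the bicompletions, with the
  same bound (\<open>bounded_linear_map_extension\<close>).  The norm of the extension cannot drop below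
  \<open>\<parallel>f|\<^sub>S\<close>: the canonical injections are isometric, so on the differences of evaluations a bound
  for the operator is precisely a semi-Lipschitz constant for \<open>f\<close>.

  A competing operator of the same, finite, norm is again continuous for the symmetrized norms, and
  it agrees with the first one on the evaluations, hence on their dense span, hence everywhere
  (\<open>bounded_linear_map_unique\<close>).
\<close>

lemma le_if_le_add_all_multiples:
  fixes a b c :: real
  assumes "\<And>e. e > 0 \<Longrightarrow> a \<le> b + e * c"
  shows "a \<le> b"
proof (rule field_le_epsilon)
  fix e :: real assume e: "e > 0"
  have "a \<le> b + e / (\<bar>c\<bar> + 1) * c" using e by (intro assms) simp
  also have "e / (\<bar>c\<bar> + 1) * c \<le> e / (\<bar>c\<bar> + 1) * (\<bar>c\<bar> + 1)"
    using e by (intro mult_left_mono) auto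
  also have "\<dots> = e" by simp
  finally show "a \<le> b + e" by simp
qed

section \<open>Asymmetric norms and linear maps\<close>

lemma linear_map_on_add:
  "linear_map_on V T \<Longrightarrow> u \<in> V \<Longrightarrow> v \<in> V \<Longrightarrow> T (u + v) = T u + T v"
  by (simp add: linear_map_on_def)

lemma linear_map_on_scale: "linear_map_on V T \<Longrightarrow> u \<in> V \<Longrightarrow> T (r *\<^sub>R u) = r *\<^sub>R T u"
  by (simp add: linear_map_on_def)

lemma linear_map_on_minus: "linear_map_on V T \<Longrightarrow> u \<in> V \<Longrightarrow> T (- u) = - T u"
  using linear_map_on_scale[of V T u "-1"] by simp

lemma linear_map_on_diff:
  "linear_map_on V T \<Longrightarrow> subspace V \<Longrightarrow> u \<in> V \<Longrightarrow> v \<in> V \<Longrightarrow> T (u - v) = T u - T v"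
  using linear_map_on_add[of V T u "- v"] linear_map_on_minus[of V T v] by (simp add: subspace_neg)

lemma linear_map_on_zero: "linear_map_on V T \<Longrightarrow> subspace V \<Longrightarrow> T 0 = 0"
  using linear_map_on_scale[of V T 0 0] by (simp add: subspace_0)

lemma linear_map_on_compose:
  assumes "linear_map_on V S" "linear_map_on W T" "S ` V \<subseteq> W"
  shows "linear_map_on V (\<lambda>v. T (S v))"
  using assms by (auto simp: linear_map_on_def image_subset_iff)

lemma linear_map_on_span_eqI:
  assumes "linear_map_on (span B) S" "linear_map_on (span B) T"
    and "\<And>b. b \<in> B \<Longrightarrow> S b = T b" and "v \<in> span B"
  shows "S v = T v"
proof -
  have "v \<in> span B \<and> S v = T v"
    using assms(4)
  proof (induction rule: span_induct_alt)
    case base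
    then show ?case using assms(1,2) by (simp add: linear_map_on_zero span_zero)
  next
    case (step c b v)
    then have "b \<in> span B" "c *\<^sub>R b \<in> span B" "v \<in> span B" "S b = T b" "S v = T v"
      using assms(3) by (auto intro: span_base span_scale)
    then show ?case
      by (simp add: span_add linear_map_on_add[OF assms(1)] linear_map_on_add[OF assms(2)]
          linear_map_on_scale[OF assms(1)] linear_map_on_scale[OF assms(2)])
  qed
  then show ?thesis by blast
qed

lemma sym_norm_minus_commute: "sym_norm p (u - v) = sym_norm p (v - u)"
  by (simp add: sym_norm_def)

context
  fixes F :: "'v::real_vector set" and p :: "'v \<Rightarrow> real"
  assumes asym: "asym_norm_on F p"
begin

lemma asym_norm_subspace: "subspace F"
  and asym_norm_nonneg: "u \<in> F \<Longrightarrow> 0 \<le> p u"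
  and asym_norm_triangle: "u \<in> F \<Longrightarrow> v \<in> F \<Longrightarrow> p (u + v) \<le> p u + p v"
  and asym_norm_scale: "t \<ge> 0 \<Longrightarrow> u \<in> F \<Longrightarrow> p (t *\<^sub>R u) = t * p u"
  and asym_norm_separates: "u \<in> F \<Longrightarrow> p u = 0 \<Longrightarrow> p (- u) = 0 \<Longrightarrow> u = 0"
  using asym unfolding asym_norm_on_def by simp_all

lemma asym_norm_zero: "p 0 = 0"
  using asym_norm_scale[of 0 0] subspace_0[OF asym_norm_subspace] by simp

lemma asym_norm_le_sym_norm: "u \<in> F \<Longrightarrow> p u \<le> sym_norm p u"
  using asym_norm_nonneg[of "- u"] subspace_neg[OF asym_norm_subspace]
  by (simp add: sym_norm_def)

lemma sym_norm_nonneg: "u \<in> F \<Longrightarrow> 0 \<le> sym_norm p u"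
  using asym_norm_nonneg asym_norm_le_sym_norm by (meson order_trans)

lemma sym_norm_triangle: "u \<in> F \<Longrightarrow> v \<in> F \<Longrightarrow> sym_norm p (u + v) \<le> sym_norm p u + sym_norm p v"
  using asym_norm_triangle[of u v] asym_norm_triangle[of "- u" "- v"]
    subspace_neg[OF asym_norm_subspace]
  by (simp add: sym_norm_def)

lemma sym_norm_scale: "u \<in> F \<Longrightarrow> sym_norm p (r *\<^sub>R u) = \<bar>r\<bar> * sym_norm p u"
  using asym_norm_scale[of r u] asym_norm_scale[of r "- u"]
    asym_norm_scale[of "- r" u] asym_norm_scale[of "- r" "- u"]
    subspace_neg[OF asym_norm_subspace, of u]
  by (cases "r \<ge> 0") (simp_all add: sym_norm_def algebra_simps)

lemma eq_if_sym_norm_diff_small: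
  assumes "u \<in> F" "v \<in> F" "\<And>e. e > 0 \<Longrightarrow> sym_norm p (u - v) \<le> e"
  shows "u = v"
proof -
  have F: "u - v \<in> F" using assms(1,2) asym_norm_subspace by (simp add: subspace_diff)
  have "sym_norm p (u - v) \<le> 0" by (rule field_le_epsilon) (use assms(3) in simp)
  then have "p (u - v) = 0 \<and> p (- (u - v)) = 0"
    using asym_norm_nonneg[OF F] asym_norm_nonneg[OF subspace_neg[OF asym_norm_subspace F]]
    by (simp add: sym_norm_def)
  then have "u - v = 0" using asym_norm_separates[OF F] by blast
  then show ?thesis by simp
qed

end

lemma sym_norm_linear_map_le:
  assumes "linear_map_on V T" "subspace V" "\<And>u. u \<in> V \<Longrightarrow> p' (T u) \<le> C * p u" "u \<in> V"
  shows "sym_norm p' (T u) \<le> C * sym_norm p u"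
  using assms(3)[of u] assms(3)[of "- u"] assms(4)
    linear_map_on_minus[OF assms(1,4)] subspace_neg[OF assms(2,4)]
  by (simp add: sym_norm_def algebra_simps)

text \<open>
  The vectors of asymmetric norm zero form a cone on which the supremum in the operator norm is
  either zero or infinite; a finite bound therefore forces such vectors to be sent to vectors of
  asymmetric norm zero, and the rest is homogeneity.
\<close>

lemma asym_op_norm_le_iff:
  assumes F1: "asym_norm_on F1 p1" and F2: "asym_norm_on F2 p2"
    and T: "T \<in> F1 \<rightarrow> F2" "linear_map_on F1 T"
  shows "asym_op_norm F1 p1 p2 T \<le> ereal C \<longleftrightarrow> 0 \<le> C \<and> (\<forall>u\<in>F1. p2 (T u) \<le> C * p1 u)"
proof
  assume "asym_op_norm F1 p1 p2 T \<le> ereal C"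
  then have ball: "p2 (T u) \<le> C" if "u \<in> F1" "p1 u \<le> 1" for u
    using that by (auto simp: asym_op_norm_def SUP_le_iff)
  have sub: "subspace F1" by (rule asym_norm_subspace[OF F1])
  have C: "0 \<le> C"
    using ball[of 0] subspace_0[OF sub] linear_map_on_zero[OF T(2) sub]
    by (simp add: asym_norm_zero[OF F1] asym_norm_zero[OF F2])
  have scale: "p2 (T (t *\<^sub>R u)) = t * p2 (T u)" if "u \<in> F1" "t \<ge> 0" for t u
    using asym_norm_scale[OF F2 that(2), of "T u"] T that(1)
    by (auto simp: linear_map_on_scale[OF T(2)])
  have "p2 (T u) \<le> C * p1 u" if u: "u \<in> F1" for u
  proof (rule le_if_le_add_all_multiples)
    fix e :: real assume e: "e > 0"
    \<comment> \<open>Dividing by \<open>p1 u + e\<close> instead of \<open>p1 u\<close> also covers the vectors with \<open>p1 u = 0\<close>.\<close>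
    define t where "t = 1 / (p1 u + e)"
    have t: "t > 0" "p1 u + e > 0" using e asym_norm_nonneg[OF F1 u] by (auto simp: t_def)
    have "p1 (t *\<^sub>R u) \<le> 1"
      using t e u by (simp add: asym_norm_scale[OF F1] t_def)
    then have "t * p2 (T u) \<le> C"
      using ball[of "t *\<^sub>R u"] scale[OF u] t subspace_scale[OF sub u] by simp
    then show "p2 (T u) \<le> C * p1 u + e * C"
      using t by (simp add: t_def pos_divide_le_eq algebra_simps)
  qed
  then show "0 \<le> C \<and> (\<forall>u\<in>F1. p2 (T u) \<le> C * p1 u)" using C by blast
next
  assume *: "0 \<le> C \<and> (\<forall>u\<in>F1. p2 (T u) \<le> C * p1 u)"
  have "p2 (T u) \<le> C" if "u \<in> F1" "p1 u \<le> 1" for u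
    using * that mult_left_mono[of "p1 u" 1 C] by fastforce
  then show "asym_op_norm F1 p1 p2 T \<le> ereal C"
    by (auto simp: asym_op_norm_def SUP_le_iff)
qed

section \<open>Extension to a bicompletion\<close>

lemma bounded_linear_map_unique:
  assumes F: "asym_norm_on F p" and F': "asym_norm_on F' p'"
    and D: "D \<subseteq> F" "\<And>u e. u \<in> F \<Longrightarrow> e > 0 \<Longrightarrow> \<exists>v\<in>D. sym_norm p (u - v) < e"
    and S: "S \<in> F \<rightarrow> F'" "linear_map_on F S" "\<And>u. u \<in> F \<Longrightarrow> p' (S u) \<le> C * p u"
    and T: "T \<in> F \<rightarrow> F'" "linear_map_on F T" "\<And>u. u \<in> F \<Longrightarrow> p' (T u) \<le> C * p u"
    and C: "0 \<le> C" and eq: "\<And>v. v \<in> D \<Longrightarrow> S v = T v" and u: "u \<in> F"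
  shows "S u = T u"
proof (rule eq_if_sym_norm_diff_small[OF F'])
  fix e :: real assume e: "e > 0"
  have sub: "subspace F" "subspace F'" using F F' by (simp_all add: asym_norm_subspace)
  \<comment> \<open>\<open>S - T\<close> has bound \<open>2 * C\<close>; the added \<open>1\<close> keeps the denominator positive when \<open>C = 0\<close>.\<close>
  have "e / (2 * C + 1) > 0" using e C by simp
  then obtain v where v: "v \<in> D" "sym_norm p (u - v) < e / (2 * C + 1)" using D(2)[OF u] by blast
  have vF: "v \<in> F" "u - v \<in> F" using v D u sub by (auto simp: subspace_diff)
  have "S u - T u = S (u - v) + - T (u - v)"
    using eq[OF v(1)] u vF sub S T by (simp add: linear_map_on_diff)
  also have "sym_norm p' \<dots> \<le> sym_norm p' (S (u - v)) + sym_norm p' (- T (u - v))"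
    using vF S T sub by (intro sym_norm_triangle[OF F']) (auto intro: subspace_neg)
  also have "sym_norm p' (- T (u - v)) = sym_norm p' (T (u - v))" by (simp add: sym_norm_def)
  also have "sym_norm p' (S (u - v)) + sym_norm p' (T (u - v)) \<le> (2 * C + 1) * sym_norm p (u - v)"
    using sym_norm_linear_map_le[where p = p and p' = p' and C = C, OF S(2) sub(1) S(3) vF(2)]
      sym_norm_linear_map_le[where p = p and p' = p' and C = C, OF T(2) sub(1) T(3) vF(2)]
      sym_norm_nonneg[OF F vF(2)]
    by (simp add: algebra_simps)
  also have "\<dots> \<le> e" using v C by (simp add: pos_less_divide_eq mult.commute)
  finally show "sym_norm p' (S u - T u) \<le> e" .
qed (use S T u in auto)

text \<open>
  The extension is the linear map whose graph is the closure of the graph of the given one.  The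
  bound passes to the closure, which makes it single-valued (a value \<open>w\<close> over \<open>0\<close> has
  \<open>p' w = p' (- w) = 0\<close>), and bicompleteness of the target gives a value over every vector.
\<close>

lemma bounded_linear_map_extension:
  assumes F: "asym_norm_on F p" and F': "asym_norm_on F' p'" and complete: "bicomplete_on F' p'"
    and V: "subspace V" and j: "linear_map_on V j" "j ` V \<subseteq> F"
    and dense: "\<And>u e. u \<in> F \<Longrightarrow> e > 0 \<Longrightarrow> \<exists>v\<in>V. sym_norm p (u - j v) < e"
    and S: "linear_map_on V S" "S ` V \<subseteq> F'" "\<And>v. v \<in> V \<Longrightarrow> p' (S v) \<le> C * p (j v)"
    and C: "0 \<le> C"
  obtains T where "T \<in> F \<rightarrow>\<^sub>E F'" "linear_map_on F T" "\<And>v. v \<in> V \<Longrightarrow> T (j v) = S v"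
    "\<And>u. u \<in> F \<Longrightarrow> p' (T u) \<le> C * p u"
proof -
  have sub: "subspace F" "subspace F'" using F F' by (simp_all add: asym_norm_subspace)
  have jF: "j v \<in> F" and SF: "S v \<in> F'" if "v \<in> V" for v using j S that by auto
  define G where "G u w \<longleftrightarrow> w \<in> F' \<and>
    (\<forall>e>0. \<exists>v\<in>V. sym_norm p (u - j v) < e \<and> sym_norm p' (w - S v) < e)" for u w
  have GF: "w \<in> F'" if "G u w" for u w using that by (simp add: G_def)
  have G_dense: "\<exists>v\<in>V. sym_norm p (u - j v) < e \<and> sym_norm p' (w - S v) < e"
    if "G u w" "e > 0" for u w e
    using that by (simp add: G_def)
  have G_base: "G (j v) (S v)" if "v \<in> V" for v
    unfolding G_def
  proof (intro conjI allI impI bexI)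
    show "sym_norm p (j v - j v) < e" "sym_norm p' (S v - S v) < e" if "e > 0" for e
      using that by (simp_all add: sym_norm_def asym_norm_zero[OF F] asym_norm_zero[OF F'])
  qed (use SF that in auto)
  have G_add: "G (u1 + u2) (w1 + w2)" if u: "u1 \<in> F" "u2 \<in> F" and w: "G u1 w1" "G u2 w2"
    for u1 u2 w1 w2
    unfolding G_def
  proof (intro conjI allI impI)
    fix e :: real assume "e > 0"
    then have e: "e / 2 > 0" by simp
    obtain v1 where v1: "v1 \<in> V" "sym_norm p (u1 - j v1) < e / 2" "sym_norm p' (w1 - S v1) < e / 2"
      using G_dense[OF w(1) e] by blast
    obtain v2 where v2: "v2 \<in> V" "sym_norm p (u2 - j v2) < e / 2" "sym_norm p' (w2 - S v2) < e / 2"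
      using G_dense[OF w(2) e] by blast
    have "u1 + u2 - j (v1 + v2) = (u1 - j v1) + (u2 - j v2)"
      using v1 v2 by (simp add: linear_map_on_add[OF j(1)])
    moreover have "sym_norm p ((u1 - j v1) + (u2 - j v2)) < e"
      using sym_norm_triangle[OF F subspace_diff[OF sub(1) u(1) jF[OF v1(1)]]
          subspace_diff[OF sub(1) u(2) jF[OF v2(1)]]] v1 v2 by linarith
    moreover have "w1 + w2 - S (v1 + v2) = (w1 - S v1) + (w2 - S v2)"
      using v1 v2 by (simp add: linear_map_on_add[OF S(1)])
    moreover have "sym_norm p' ((w1 - S v1) + (w2 - S v2)) < e"
      using sym_norm_triangle[OF F' subspace_diff[OF sub(2) GF[OF w(1)] SF[OF v1(1)]]
          subspace_diff[OF sub(2) GF[OF w(2)] SF[OF v2(1)]]] v1 v2 by linarith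
    ultimately show "\<exists>v\<in>V. sym_norm p (u1 + u2 - j v) < e \<and> sym_norm p' (w1 + w2 - S v) < e"
      using subspace_add[OF V v1(1) v2(1)] by metis
  qed (use GF w sub in \<open>auto intro: subspace_add\<close>)
  have G_scale: "G (r *\<^sub>R u) (r *\<^sub>R w)" if u: "u \<in> F" and w: "G u w" for r u w
    unfolding G_def
  proof (intro conjI allI impI)
    fix e :: real assume e: "e > 0"
    then have "e / (\<bar>r\<bar> + 1) > 0" by simp
    then obtain v where v: "v \<in> V" "sym_norm p (u - j v) < e / (\<bar>r\<bar> + 1)"
      "sym_norm p' (w - S v) < e / (\<bar>r\<bar> + 1)"
      using G_dense[OF w] by blast
    have small: "\<bar>r\<bar> * a < e" if "a < e / (\<bar>r\<bar> + 1)" "0 \<le> a" for a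
    proof -
      have "\<bar>r\<bar> * a \<le> (\<bar>r\<bar> + 1) * a" using that by (intro mult_right_mono) auto
      also have "\<dots> < e" using that by (simp add: pos_less_divide_eq mult.commute)
      finally show ?thesis .
    qed
    have uF: "u - j v \<in> F" "w - S v \<in> F'"
      using u GF[OF w] jF[OF v(1)] SF[OF v(1)] sub by (auto intro: subspace_diff)
    have "r *\<^sub>R u - j (r *\<^sub>R v) = r *\<^sub>R (u - j v)" "r *\<^sub>R w - S (r *\<^sub>R v) = r *\<^sub>R (w - S v)"
      using v by (simp_all add: linear_map_on_scale[OF j(1)] linear_map_on_scale[OF S(1)]
          scaleR_right_diff_distrib)
    then have "sym_norm p (r *\<^sub>R u - j (r *\<^sub>R v)) < e" "sym_norm p' (r *\<^sub>R w - S (r *\<^sub>R v)) < e"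
      using small v uF sym_norm_nonneg[OF F] sym_norm_nonneg[OF F']
      by (simp_all add: sym_norm_scale[OF F] sym_norm_scale[OF F'])
    then show "\<exists>v\<in>V. sym_norm p (r *\<^sub>R u - j v) < e \<and> sym_norm p' (r *\<^sub>R w - S v) < e"
      using subspace_scale[OF V v(1)] by blast
  qed (use GF w sub in \<open>auto intro: subspace_scale\<close>)
  have G_bound: "p' w \<le> C * p u" if u: "u \<in> F" and w: "G u w" for u w
  proof (rule le_if_le_add_all_multiples)
    fix e :: real assume e: "e > 0"
    obtain v where v: "v \<in> V" "sym_norm p (u - j v) < e" "sym_norm p' (w - S v) < e"
      using G_dense[OF w e] by blast
    have uF: "j v - u \<in> F" "w - S v \<in> F'"
      using u GF[OF w] jF[OF v(1)] SF[OF v(1)] sub by (auto intro: subspace_diff)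
    have jv: "p (j v) \<le> p u + e"
      using asym_norm_triangle[OF F u uF(1)] asym_norm_le_sym_norm[OF F uF(1)] v
        sym_norm_minus_commute[of p u "j v"] by simp
    have "p' w \<le> p' (w - S v) + p' (S v)"
      using asym_norm_triangle[OF F' uF(2) SF[OF v(1)]] by simp
    also have "\<dots> \<le> e + C * p (j v)"
      using asym_norm_le_sym_norm[OF F' uF(2)] v S(3)[OF v(1)] by simp
    also have "\<dots> \<le> e + C * (p u + e)" using jv C by (simp add: mult_left_mono)
    finally show "p' w \<le> C * p u + e * (C + 1)" by (simp add: algebra_simps)
  qed
  \<comment> \<open>A nonzero vector can have norm zero, so both \<open>w1 - w2\<close> and its negative are bounded.\<close>
  have G_unique: "w1 = w2" if u: "u \<in> F" and w: "G u w1" "G u w2" for u w1 w2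
  proof -
    have le: "p' (a - b) \<le> 0" if "G u a" "G u b" for a b
    proof -
      have "G (u + (-1) *\<^sub>R u) (a + (-1) *\<^sub>R b)"
        using u that sub by (intro G_add G_scale) (auto intro: subspace_neg)
      then show ?thesis
        using G_bound[of 0 "a - b"] subspace_0[OF sub(1)] by (simp add: asym_norm_zero[OF F])
    qed
    have "w1 - w2 \<in> F'" "w2 - w1 \<in> F'" using GF w sub by (auto intro: subspace_diff)
    then have "p' (w1 - w2) = 0" "p' (w2 - w1) = 0"
      using le w asym_norm_nonneg[OF F'] by (auto intro: antisym)
    then have "w1 - w2 = 0"
      using asym_norm_separates[OF F' \<open>w1 - w2 \<in> F'\<close>] by simp
    then show ?thesis by simp
  qed
  have G_exists: "\<exists>w. G u w" if u: "u \<in> F" for u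
  proof -
    have "\<exists>v\<in>V. sym_norm p (u - j v) < inverse (real (Suc n))" for n
      using dense[OF u] by simp
    then obtain v where vV: "\<And>n. v n \<in> V"
      and v: "\<And>n. sym_norm p (u - j (v n)) < inverse (real (Suc n))"
      by metis
    have approx: "\<exists>N. \<forall>n\<ge>N. sym_norm p (u - j (v n)) < e" if "e > 0" for e
    proof -
      obtain N where N: "inverse (real (Suc N)) < e" using reals_Archimedean[OF \<open>e > 0\<close>] by blast
      have "sym_norm p (u - j (v n)) < e" if "n \<ge> N" for n
      proof -
        have "inverse (real (Suc n)) \<le> inverse (real (Suc N))"
          using that by (intro le_imp_inverse_le) auto
        then show ?thesis using v[of n] N by linarith
      qed
      then show ?thesis by blast
    qed
    have uF: "u - j (v n) \<in> F" "j (v n) - u \<in> F" for n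
      using u jF[OF vV] sub by (auto intro: subspace_diff)
    have cauchy: "\<exists>N. \<forall>m\<ge>N. \<forall>n\<ge>N. sym_norm p' (S (v m) - S (v n)) < e" if e: "e > 0" for e
    proof -
      have "e / (C + 1) / 2 > 0" using e C by simp
      then obtain N where N: "\<forall>n\<ge>N. sym_norm p (u - j (v n)) < e / (C + 1) / 2"
        using approx by blast
      have "sym_norm p' (S (v m) - S (v n)) < e" if mn: "m \<ge> N" "n \<ge> N" for m n
      proof -
        have d: "v m - v n \<in> V" using vV V by (simp add: subspace_diff)
        have "S (v m) - S (v n) = S (v m - v n)"
          using vV by (simp add: linear_map_on_diff[OF S(1) V])
        also have "sym_norm p' \<dots> \<le> C * sym_norm (\<lambda>x. p (j x)) (v m - v n)"
          by (rule sym_norm_linear_map_le[where p = "\<lambda>x. p (j x)" and p' = p' and C = C,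
                OF S(1) V S(3) d])
        also have "sym_norm (\<lambda>x. p (j x)) (v m - v n) = sym_norm p (j (v m) - j (v n))"
          using linear_map_on_minus[OF j(1) d] vV
          by (simp add: sym_norm_def linear_map_on_diff[OF j(1) V])
        also have "\<dots> \<le> sym_norm p (j (v m) - u) + sym_norm p (u - j (v n))"
          using sym_norm_triangle[OF F uF(2)[of m] uF(1)[of n]] by simp
        also have "\<dots> \<le> e / (C + 1) / 2 + e / (C + 1) / 2"
          using N mn sym_norm_minus_commute[of p u "j (v m)"] by (intro add_mono) auto
        also have "\<dots> = e / (C + 1)" by (rule field_sum_of_halves)
        also have "C * (e / (C + 1)) < e" using C e by (simp add: field_simps)
        finally show ?thesis using C by (simp add: mult_left_mono)
      qed
      then show ?thesis by blast
    qed
    have "range (\<lambda>n. S (v n)) \<subseteq> F'" using SF vV by auto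
    then obtain l where l: "l \<in> F'" "(\<lambda>n. sym_norm p' (S (v n) - l)) \<longlonglongrightarrow> 0"
      using cauchy complete[unfolded bicomplete_on_def, rule_format, of "\<lambda>n. S (v n)"] by blast
    have "\<exists>v\<in>V. sym_norm p (u - j v) < e \<and> sym_norm p' (l - S v) < e" if e: "e > 0" for e
    proof -
      obtain N where N: "\<forall>n\<ge>N. sym_norm p (u - j (v n)) < e" using approx[OF e] by blast
      obtain M where "\<forall>n\<ge>M. norm (sym_norm p' (S (v n) - l) - 0) < e"
        using LIMSEQ_D[OF l(2) e] by blast
      then have M: "\<forall>n\<ge>M. sym_norm p' (l - S (v n)) < e"
        using sym_norm_minus_commute[of p' l] by auto
      show ?thesis using N M vV by (intro bexI[of _ "v (max M N)"]) auto
    qed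
    then show ?thesis using l(1) by (auto simp: G_def)
  qed
  define T where "T = (\<lambda>u\<in>F. THE w. G u w)"
  have GT: "G u (T u)" if "u \<in> F" for u
    using theI'[of "G u"] G_exists[OF that] G_unique[OF that] that by (auto simp: T_def)
  have T_eq: "T u = w" if "u \<in> F" "G u w" for u w
    using G_unique[OF that(1) GT that(2)] that(1) .
  show thesis
  proof
    show "T \<in> F \<rightarrow>\<^sub>E F'" using GF GT by (auto simp: T_def)
    show "linear_map_on F T"
      unfolding linear_map_on_def
      using sub(1) GT by (auto intro!: T_eq G_add G_scale intro: subspace_add subspace_scale)
    show "T (j v) = S v" if "v \<in> V" for v using T_eq jF[OF that] G_base[OF that] .
    show "p' (T u) \<le> C * p u" if "u \<in> F" for u using G_bound[OF that GT[OF that]] .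
  qed
qed

section \<open>Semi-Lipschitz maps and the transpose of composition\<close>

lemma slip_map_norm_le:
  assumes X1: "quasi_metric X1 d1" and "0 \<le> C"
    and C: "\<And>x y. x \<in> X1 \<Longrightarrow> y \<in> X1 \<Longrightarrow> d2 (f y) (f x) \<le> C * d1 y x"
  shows "slip_map_norm X1 d1 d2 f \<le> C"
proof (rule field_le_epsilon)
  fix e :: real assume e: "e > 0"
  have "d2 (f y) (f x) \<le> (C + e) * d1 y x" if "x \<in> X1" "y \<in> X1" for x y
  proof -
    have "C * d1 y x \<le> (C + e) * d1 y x"
      using e X1 that by (intro mult_right_mono) (auto simp: quasi_metric_def)
    then show ?thesis using C[OF that] by linarith
  qed
  then show "slip_map_norm X1 d1 d2 f \<le> C + e"
    unfolding slip_map_norm_def using e \<open>0 \<le> C\<close>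
    by (intro cInf_lower) (auto intro: bdd_belowI[of _ 0])
qed

text \<open>
  For each pair of points the inequality survives the passage from the constants \<open>L\<close> to their
  infimum, because it is linear in \<open>L\<close> with the finite slope \<open>d1 y x\<close>.
\<close>

lemma slip_map_norm_bound:
  assumes X1: "quasi_metric X1 d1" and f: "f \<in> SLip0_map X1 d1 x1 X2 d2 x2"
  shows "0 \<le> slip_map_norm X1 d1 d2 f"
    and "x \<in> X1 \<Longrightarrow> y \<in> X1 \<Longrightarrow> d2 (f y) (f x) \<le> slip_map_norm X1 d1 d2 f * d1 y x"
proof -
  let ?A = "{L. L > 0 \<and> (\<forall>x\<in>X1. \<forall>y\<in>X1. d2 (f y) (f x) \<le> L * d1 y x)}"
  have d: "0 \<le> d1 y x" if "x \<in> X1" "y \<in> X1" for x y using X1 that by (auto simp: quasi_metric_def)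
  obtain L where L: "L \<ge> 0" "\<And>x y. x \<in> X1 \<Longrightarrow> y \<in> X1 \<Longrightarrow> d2 (f y) (f x) \<le> L * d1 y x"
    using f by (auto simp: SLip0_map_def)
  have "d2 (f y) (f x) \<le> (L + 1) * d1 y x" if "x \<in> X1" "y \<in> X1" for x y
    using L(2)[OF that] d[OF that] by (simp add: algebra_simps)
  then have ne: "?A \<noteq> {}" using L(1) by (auto intro!: exI[of _ "L + 1"])
  show "0 \<le> slip_map_norm X1 d1 d2 f"
    unfolding slip_map_norm_def using ne by (intro cInf_greatest) auto
  assume xy: "x \<in> X1" "y \<in> X1"
  show "d2 (f y) (f x) \<le> slip_map_norm X1 d1 d2 f * d1 y x"
  proof (rule le_if_le_add_all_multiples)
    fix e :: real assume "e > 0"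
    then have "Inf ?A < slip_map_norm X1 d1 d2 f + e" by (simp add: slip_map_norm_def)
    then obtain L where L: "L \<in> ?A" "L < slip_map_norm X1 d1 d2 f + e"
      using cInf_lessD[OF ne] by blast
    have "d2 (f y) (f x) \<le> L * d1 y x" using L xy by blast
    also have "\<dots> \<le> (slip_map_norm X1 d1 d2 f + e) * d1 y x"
      using L d[OF xy] by (intro mult_right_mono) auto
    finally show "d2 (f y) (f x) \<le> slip_map_norm X1 d1 d2 f * d1 y x + e * d1 y x"
      by (simp add: algebra_simps)
  qed
qed

text \<open>
  Composition \<open>g \<circ> f\<close> and its transpose, both extended by zero, so that they respect the
  representation of functions on \<open>X\<close> and of functionals on the cone of semi-Lipschitz functions.
\<close>

definition slip_pullback :: "'a set \<Rightarrow> ('a \<Rightarrow> 'b) \<Rightarrow> ('b \<Rightarrow> real) \<Rightarrow> 'a \<Rightarrow> real" where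
  "slip_pullback X f g = (\<lambda>x. if x \<in> X then g (f x) else 0)"

definition slip_pushforward ::
  "'a set \<Rightarrow> 'b set \<Rightarrow> ('b \<Rightarrow> 'b \<Rightarrow> real) \<Rightarrow> 'b \<Rightarrow> ('a \<Rightarrow> 'b) \<Rightarrow>
   (('a \<Rightarrow> real) \<Rightarrow> real) \<Rightarrow> ('b \<Rightarrow> real) \<Rightarrow> real" where
  "slip_pushforward X1 X2 d2 x2 f \<gamma> =
     (\<lambda>g. if g \<in> SLip0 X2 d2 x2 then \<gamma> (slip_pullback X1 f g) else 0)"

lemma linear_slip_pushforward: "linear_map_on V (slip_pushforward X1 X2 d2 x2 f)"
  by (auto simp: linear_map_on_def slip_pushforward_def fun_eq_iff)

lemma slip_pullback_scaled_in_slip_ball: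
  assumes X1: "pointed_quasi_metric X1 d1 x1" and X2: "quasi_metric X2 d2"
    and f: "f \<in> SLip0_map X1 d1 x1 X2 d2 x2" and C: "slip_map_norm X1 d1 d2 f < C"
    and g: "g \<in> slip_ball X2 d2 x2"
  shows "(1 / C) *\<^sub>R slip_pullback X1 f g \<in> slip_ball X1 d1 x1"
proof (rule slip_ballI)
  have q: "quasi_metric X1 d1" "x1 \<in> X1" using X1 by (auto simp: pointed_quasi_metric_def)
  have C0: "C > 0" using slip_map_norm_bound(1)[OF q(1) f] C by simp
  fix x y assume xy: "x \<in> X1" "y \<in> X1"
  have "g (f x) - g (f y) \<le> d2 (f y) (f x)"
    using f xy by (intro slip_ball_le[OF X2 g]) (auto simp: SLip0_map_def)
  also have "\<dots> \<le> slip_map_norm X1 d1 d2 f * d1 y x" by (rule slip_map_norm_bound(2)[OF q(1) f xy])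
  also have "\<dots> \<le> C * d1 y x"
    using C q xy by (intro mult_right_mono) (auto simp: quasi_metric_def)
  finally have "(g (f x) - g (f y)) / C \<le> d1 y x"
    using C0 by (simp add: pos_divide_le_eq mult.commute)
  then show "((1 / C) *\<^sub>R slip_pullback X1 f g) x - ((1 / C) *\<^sub>R slip_pullback X1 f g) y \<le> d1 y x"
    using xy by (simp add: slip_pullback_def diff_divide_distrib)
qed (use f g X1 in \<open>auto simp: slip_pullback_def SLip0_map_def slip_ball_def SLip0_def
      pointed_quasi_metric_def\<close>)

lemma slip_pullback_in_SLip0:
  assumes X1: "pointed_quasi_metric X1 d1 x1" and X2: "quasi_metric X2 d2"
    and f: "f \<in> SLip0_map X1 d1 x1 X2 d2 x2" and g: "g \<in> SLip0 X2 d2 x2"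
  shows "slip_pullback X1 f g \<in> SLip0 X1 d1 x1"
proof -
  have q: "quasi_metric X1 d1" using X1 by (simp add: pointed_quasi_metric_def)
  define C where "C = slip_map_norm X1 d1 d2 f + 1"
  have C: "C > 0" "slip_map_norm X1 d1 d2 f < C"
    using slip_map_norm_bound(1)[OF q f] by (simp_all add: C_def)
  obtain L h where h: "L > 0" "h \<in> slip_ball X2 d2 x2" "g = L *\<^sub>R h"
    using g by (rule SLip0_rescale)
  have "slip_pullback X1 f g = (L * C) *\<^sub>R ((1 / C) *\<^sub>R slip_pullback X1 f h)"
    using C by (auto simp: h slip_pullback_def fun_eq_iff)
  also have "\<dots> \<in> SLip0 X1 d1 x1"
    using slip_pullback_scaled_in_slip_ball[OF X1 X2 f C(2) h(2)] h C
    by (intro SLip0_scale[OF q] slip_ball_subset) auto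
  finally show ?thesis .
qed

lemma slip_pushforward_delta:
  assumes "pointed_quasi_metric X1 d1 x1" "quasi_metric X2 d2"
    and "f \<in> SLip0_map X1 d1 x1 X2 d2 x2" and "x \<in> X1"
  shows "slip_pushforward X1 X2 d2 x2 f (delta X1 d1 x1 x) = delta X2 d2 x2 (f x)"
  using slip_pullback_in_SLip0[OF assms(1-3)] assms(4)
  by (auto simp: slip_pushforward_def delta_def slip_pullback_def fun_eq_iff)

lemma slip_pushforward_in_delta_span:
  assumes "pointed_quasi_metric X1 d1 x1" "quasi_metric X2 d2"
    and f: "f \<in> SLip0_map X1 d1 x1 X2 d2 x2" and "\<gamma> \<in> delta_span X1 d1 x1"
  shows "slip_pushforward X1 X2 d2 x2 f \<gamma> \<in> delta_span X2 d2 x2"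
  using assms(4) unfolding delta_span_def
proof (induction rule: span_induct_alt)
  case base
  have "slip_pushforward X1 X2 d2 x2 f 0 = 0" by (simp add: slip_pushforward_def fun_eq_iff)
  then show ?case by (simp only: span_zero)
next
  case (step c b v)
  then obtain x where x: "x \<in> X1" "b = delta X1 d1 x1 x" by auto
  have "slip_pushforward X1 X2 d2 x2 f (c *\<^sub>R b + v) =
      c *\<^sub>R delta X2 d2 x2 (f x) + slip_pushforward X1 X2 d2 x2 f v"
    unfolding x(2) slip_pushforward_delta[OF assms(1-3) x(1), symmetric]
    by (auto simp: slip_pushforward_def fun_eq_iff)
  moreover have "f x \<in> X2" using f x by (auto simp: SLip0_map_def)
  ultimately show ?case
    using step.IH by (simp only: span_add span_scale span_base imageI)
qed

text \<open>
  A functional in the span is bounded on the unit ball, so its supremum there is a genuine one.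
\<close>

lemma dual_norm_upper:
  assumes X: "pointed_quasi_metric X d x0" and \<gamma>: "\<gamma> \<in> delta_span X d x0"
    and g: "g \<in> slip_ball X d x0"
  shows "\<gamma> g \<le> dual_norm X d x0 \<gamma>"
proof -
  obtain C where "\<forall>g\<in>slip_ball X d x0. \<bar>\<gamma> g\<bar> \<le> C" using delta_span_props[OF X \<gamma>] by blast
  then have "bdd_above (\<gamma> ` slip_ball X d x0)" by (intro bdd_aboveI2[of _ _ C]) (auto simp: abs_le_iff)
  then show ?thesis unfolding dual_norm_def by (rule cSUP_upper[OF g])
qed

text \<open>
  For \<open>g\<close> in the unit ball, \<open>(g \<circ> f) / C\<close> lies in the unit ball whenever \<open>C > \<parallel>f|\<^sub>S\<close>, and \<open>\<gamma>\<close> is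
  positively homogeneous.  The strict inequality keeps \<open>C\<close> positive when \<open>\<parallel>f|\<^sub>S = 0\<close>; afterwards
  \<open>C\<close> tends to \<open>\<parallel>f|\<^sub>S\<close>.
\<close>

lemma dual_norm_pushforward_le:
  assumes X1: "pointed_quasi_metric X1 d1 x1" and X2: "quasi_metric X2 d2"
    and f: "f \<in> SLip0_map X1 d1 x1 X2 d2 x2" and \<gamma>: "\<gamma> \<in> delta_span X1 d1 x1"
  shows "dual_norm X2 d2 x2 (slip_pushforward X1 X2 d2 x2 f \<gamma>)
    \<le> slip_map_norm X1 d1 d2 f * dual_norm X1 d1 x1 \<gamma>"
proof (rule le_if_le_add_all_multiples)
  fix e :: real assume e: "e > 0"
  have q: "quasi_metric X1 d1" using X1 by (simp add: pointed_quasi_metric_def)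
  define C where "C = slip_map_norm X1 d1 d2 f + e"
  have C: "C > 0" "slip_map_norm X1 d1 d2 f < C"
    using slip_map_norm_bound(1)[OF q f] e by (simp_all add: C_def)
  have "dual_norm X2 d2 x2 (slip_pushforward X1 X2 d2 x2 f \<gamma>) \<le> C * dual_norm X1 d1 x1 \<gamma>"
    unfolding dual_norm_def[of X2]
  proof (rule cSUP_least)
    show "slip_ball X2 d2 x2 \<noteq> {}" using zero_in_slip_ball[OF X2] by blast
    fix g assume g: "g \<in> slip_ball X2 d2 x2"
    let ?h = "(1 / C) *\<^sub>R slip_pullback X1 f g"
    have h: "?h \<in> slip_ball X1 d1 x1"
      by (rule slip_pullback_scaled_in_slip_ball[OF X1 X2 f C(2) g])
    have "slip_pushforward X1 X2 d2 x2 f \<gamma> g = \<gamma> (C *\<^sub>R ?h)"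
      using slip_ball_subset[OF g] C by (simp add: slip_pushforward_def)
    also have "\<dots> = C * \<gamma> ?h"
      using delta_span_props[OF X1 \<gamma>] slip_ball_subset[OF h] C less_imp_le by blast
    also have "\<dots> \<le> C * dual_norm X1 d1 x1 \<gamma>"
      using dual_norm_upper[OF X1 \<gamma> h] C by (intro mult_left_mono) auto
    finally show "slip_pushforward X1 X2 d2 x2 f \<gamma> g \<le> C * dual_norm X1 d1 x1 \<gamma>" .
  qed
  then show "dual_norm X2 d2 x2 (slip_pushforward X1 X2 d2 x2 f \<gamma>)
    \<le> slip_map_norm X1 d1 d2 f * dual_norm X1 d1 x1 \<gamma> + e * dual_norm X1 d1 x1 \<gamma>"
    by (simp add: C_def algebra_simps)
qed

section \<open>The linearization of a semi-Lipschitz map\<close>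

lemma free_space_delta_diff_norm:
  assumes X: "pointed_quasi_metric X d x0" and F: "semi_lipschitz_free_space X d x0 F p j"
    and xy: "x \<in> X" "y \<in> X"
  shows "p (j (delta X d x0 x) - j (delta X d x0 y)) = d y x"
proof -
  have V: "subspace (delta_span X d x0)" by (simp add: delta_span_def)
  have x: "delta X d x0 x \<in> delta_span X d x0" and y: "delta X d x0 y \<in> delta_span X d x0"
    using xy by (simp_all add: delta_span_def span_base)
  have "linear_map_on (delta_span X d x0) j"
    and iso: "\<And>\<gamma>. \<gamma> \<in> delta_span X d x0 \<Longrightarrow> p (j \<gamma>) = dual_norm X d x0 \<gamma>"
    using F by (auto simp: semi_lipschitz_free_space_def bicompletion_def)
  then have "j (delta X d x0 x) - j (delta X d x0 y) = j (delta X d x0 x - delta X d x0 y)"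
    using linear_map_on_diff V x y by metis
  then show ?thesis
    using iso[OF subspace_diff[OF V x y]] delta_isometric[OF X xy] by simp
qed

theorem corollary4p4:
  fixes X1 :: "'a set" and d1 :: "'a \<Rightarrow> 'a \<Rightarrow> real" and x1 :: 'a
    and X2 :: "'b set" and d2 :: "'b \<Rightarrow> 'b \<Rightarrow> real" and x2 :: 'b
    and f :: "'a \<Rightarrow> 'b"
    and F1 :: "'v::real_vector set" and p1 :: "'v \<Rightarrow> real" and j1 :: "(('a \<Rightarrow> real) \<Rightarrow> real) \<Rightarrow> 'v"
    and F2 :: "'w::real_vector set" and p2 :: "'w \<Rightarrow> real" and j2 :: "(('b \<Rightarrow> real) \<Rightarrow> real) \<Rightarrow> 'w"
  assumes "pointed_quasi_metric X1 d1 x1"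
    and "pointed_quasi_metric X2 d2 x2"
    and "f \<in> SLip0_map X1 d1 x1 X2 d2 x2"
    and "semi_lipschitz_free_space X1 d1 x1 F1 p1 j1"
    and "semi_lipschitz_free_space X2 d2 x2 F2 p2 j2"
  shows "\<exists>!T. T \<in> F1 \<rightarrow>\<^sub>E F2 \<and> linear_map_on F1 T \<and>
           (\<forall>x\<in>X1. T (j1 (delta X1 d1 x1 x)) = j2 (delta X2 d2 x2 (f x))) \<and>
           asym_op_norm F1 p1 p2 T = ereal (slip_map_norm X1 d1 d2 f)"
proof -
  note X1 = assms(1) and X2 = assms(2) and f = assms(3)
  have q: "quasi_metric X1 d1" "quasi_metric X2 d2"
    using X1 X2 by (simp_all add: pointed_quasi_metric_def)
  let ?V1 = "delta_span X1 d1 x1" and ?V2 = "delta_span X2 d2 x2"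
  let ?C = "slip_map_norm X1 d1 d2 f"
  let ?P = "slip_pushforward X1 X2 d2 x2 f"
  have F1: "asym_norm_on F1 p1" and j1: "linear_map_on ?V1 j1" "j1 ` ?V1 \<subseteq> F1"
    and iso1: "\<And>\<gamma>. \<gamma> \<in> ?V1 \<Longrightarrow> p1 (j1 \<gamma>) = dual_norm X1 d1 x1 \<gamma>"
    and dense: "\<And>u e. u \<in> F1 \<Longrightarrow> e > 0 \<Longrightarrow> \<exists>\<gamma>\<in>?V1. sym_norm p1 (u - j1 \<gamma>) < e"
    using assms(4) by (auto simp: semi_lipschitz_free_space_def bicompletion_def)
  have F2: "asym_norm_on F2 p2" "bicomplete_on F2 p2"
    and j2: "linear_map_on ?V2 j2" "j2 ` ?V2 \<subseteq> F2"
    and iso2: "\<And>\<gamma>. \<gamma> \<in> ?V2 \<Longrightarrow> p2 (j2 \<gamma>) = dual_norm X2 d2 x2 \<gamma>"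
    using assms(5) by (auto simp: semi_lipschitz_free_space_def bicompletion_def)
  have V1: "subspace ?V1" by (simp add: delta_span_def)
  have C: "0 \<le> ?C" by (rule slip_map_norm_bound(1)[OF q(1) f])
  have P: "?P ` ?V1 \<subseteq> ?V2" using slip_pushforward_in_delta_span[OF X1 q(2) f] by blast
  have S: "linear_map_on ?V1 (\<lambda>\<gamma>. j2 (?P \<gamma>))"
    by (rule linear_map_on_compose[OF linear_slip_pushforward j2(1) P])
  have S_bound: "p2 (j2 (?P \<gamma>)) \<le> ?C * p1 (j1 \<gamma>)" if "\<gamma> \<in> ?V1" for \<gamma>
  proof -
    have "?P \<gamma> \<in> ?V2" using P that by blast
    then show ?thesis using dual_norm_pushforward_le[OF X1 q(2) f that] iso1[OF that] iso2 by simp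
  qed
  have S_into: "(\<lambda>\<gamma>. j2 (?P \<gamma>)) ` ?V1 \<subseteq> F2" using P j2(2) by blast
  obtain T where T: "T \<in> F1 \<rightarrow>\<^sub>E F2" "linear_map_on F1 T"
    "\<And>\<gamma>. \<gamma> \<in> ?V1 \<Longrightarrow> T (j1 \<gamma>) = j2 (?P \<gamma>)" "\<And>u. u \<in> F1 \<Longrightarrow> p2 (T u) \<le> ?C * p1 u"
    using bounded_linear_map_extension[OF F1 F2 V1 j1 dense S S_into S_bound C] by blast
  have delta_V1: "delta X1 d1 x1 x \<in> ?V1" if "x \<in> X1" for x
    using that by (simp add: delta_span_def span_base)
  have T_delta: "T (j1 (delta X1 d1 x1 x)) = j2 (delta X2 d2 x2 (f x))" if "x \<in> X1" for x
    using T(3)[OF delta_V1[OF that]] slip_pushforward_delta[OF X1 q(2) f that] by simp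
  have T_into: "T \<in> F1 \<rightarrow> F2" using T(1) by auto
  have le: "asym_op_norm F1 p1 p2 T \<le> ereal ?C"
    using asym_op_norm_le_iff[OF F1 F2(1) T_into T(2)] C T(4) by blast
  \<comment> \<open>Quantifying over the finite upper bounds \<open>c\<close> avoids a case distinction in the extended reals.\<close>
  have ge: "ereal ?C \<le> asym_op_norm F1 p1 p2 T"
  proof -
    have least: "?C \<le> c" if c: "asym_op_norm F1 p1 p2 T \<le> ereal c" for c
    proof (rule slip_map_norm_le[OF q(1)])
      have bound: "0 \<le> c" "\<And>u. u \<in> F1 \<Longrightarrow> p2 (T u) \<le> c * p1 u"
        using asym_op_norm_le_iff[OF F1 F2(1) T_into T(2)] c by blast+
      show "0 \<le> c" by fact
      fix x y assume xy: "x \<in> X1" "y \<in> X1"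
      let ?x = "j1 (delta X1 d1 x1 x)" and ?y = "j1 (delta X1 d1 x1 y)"
      have F: "?x \<in> F1" "?y \<in> F1" using j1(2) delta_V1 xy by blast+
      have fxy: "f x \<in> X2" "f y \<in> X2" using f xy by (auto simp: SLip0_map_def)
      have "d2 (f y) (f x) = p2 (T (?x - ?y))"
        using free_space_delta_diff_norm[OF X2 assms(5) fxy] F xy T_delta
        by (simp add: linear_map_on_diff[OF T(2) asym_norm_subspace[OF F1]])
      also have "\<dots> \<le> c * p1 (?x - ?y)"
        by (rule bound(2)[OF subspace_diff[OF asym_norm_subspace[OF F1] F]])
      also have "\<dots> = c * d1 y x" using free_space_delta_diff_norm[OF X1 assms(4) xy] by simp
      finally show "d2 (f y) (f x) \<le> c * d1 y x" .
    qed
    show ?thesis by (rule ereal_le_real) (use least in simp)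
  qed
  show ?thesis
  proof (rule ex1I[of _ T])
    show "T \<in> F1 \<rightarrow>\<^sub>E F2 \<and> linear_map_on F1 T \<and>
      (\<forall>x\<in>X1. T (j1 (delta X1 d1 x1 x)) = j2 (delta X2 d2 x2 (f x))) \<and>
      asym_op_norm F1 p1 p2 T = ereal ?C"
      using T(1,2) T_delta antisym[OF le ge] by blast
  next
    fix U assume U: "U \<in> F1 \<rightarrow>\<^sub>E F2 \<and> linear_map_on F1 U \<and>
      (\<forall>x\<in>X1. U (j1 (delta X1 d1 x1 x)) = j2 (delta X2 d2 x2 (f x))) \<and>
      asym_op_norm F1 p1 p2 U = ereal ?C"
    have U_into: "U \<in> F1 \<rightarrow> F2" and U_lin: "linear_map_on F1 U" using U by auto
    have U_bound: "p2 (U u) \<le> ?C * p1 u" if "u \<in> F1" for u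
      using asym_op_norm_le_iff[OF F1 F2(1) U_into U_lin, of ?C] U that by simp
    have on_span: "U (j1 \<gamma>) = T (j1 \<gamma>)" if "\<gamma> \<in> ?V1" for \<gamma>
    proof (rule linear_map_on_span_eqI[where
          S = "\<lambda>\<gamma>. U (j1 \<gamma>)" and T = "\<lambda>\<gamma>. T (j1 \<gamma>)"])
      show "linear_map_on (span (delta X1 d1 x1 ` X1)) (\<lambda>\<gamma>. U (j1 \<gamma>))"
        using linear_map_on_compose[OF j1(1) U_lin j1(2)] unfolding delta_span_def .
      show "linear_map_on (span (delta X1 d1 x1 ` X1)) (\<lambda>\<gamma>. T (j1 \<gamma>))"
        using linear_map_on_compose[OF j1(1) T(2) j1(2)] unfolding delta_span_def .
      show "\<gamma> \<in> span (delta X1 d1 x1 ` X1)" using that unfolding delta_span_def .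
    next
      fix b assume "b \<in> delta X1 d1 x1 ` X1"
      then obtain x where "x \<in> X1" "b = delta X1 d1 x1 x" by blast
      then show "U (j1 b) = T (j1 b)" using U T_delta by simp
    qed
    have "U u = T u" if "u \<in> F1" for u
      by (rule bounded_linear_map_unique[OF F1 F2(1) j1(2) _ U_into U_lin U_bound
            T_into T(2) T(4) C _ that]) (use dense on_span in blast)+
    then show "U = T" using U T(1) by (intro extensionalityI[of _ F1]) (auto simp: PiE_def)
  qed
qed

end
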